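(* Let $q$ be a prime power, let $v,n$ be positive integers with $2\le n<v$, and let $k,\lambda_1,\lambda_2$ be non-negative integers. If $\mathcal{E}$ is a $q$-ary divisible design graph ($q$-DDG) with parameters $(v,k,\lambda_1,\lambda_2,n;q)$ with respect to an $n$-spread $\mathcal{G}$ of $\mathbb{F}_q^v$, then $\mathcal{E}$ is trivial, that is, one of the following holds: (i) $\mathcal{E}$ is the complete $q$-ary graph (all $2$-dimensional subspaces of $\mathbb{F}_q^v$ are edges); (ii) $\mathcal{E}$ is the disjoint union of the complete $q$-ary graphs on the elements of $\mathcal{G}$ (the edges are exactly the $2$-dimensional subspaces contained in some element of $\mathcal{G}$); (iii) $\mathcal{E}$ is the empty $q$-ary graph (no edges).
   Context: A $q$-ary graph $\mathcal{E}$ on $\mathbb{F}_q^v$ is a pair $(V,E)$ where $V$ is the set of all $1$-dimensional subspaces of $\mathbb{F}_q^v$ (vertices) and $E$ is a set of $2$-dimensional subspaces of $\mathbb{F}_q^v$ (edges). Distinct vertices $X,Y$ are adjacent if $\langle X,Y\rangle\in E$. The neighborhood $N_{\mathcal{E}}(X)$ is the set consisting of $X$ and all vertices adjacent to $X$. $\mathcal{E}$ is $k$-regular if for every vertex $X$ the set $N_{\mathcal{E}}(X)$ is (the set of $1$-subspaces of) a $(k+1)$-dimensional subspace of $\mathbb{F}_q^v$. An $n$-spread of $\mathbb{F}_q^v$ is a set of $n$-dimensional subspaces such that every nonzero vector lies in exactly one of them. Given an $n$-spread $\mathcal{G}$ of $\mathbb{F}_q^v$, a $k$-regular $q$-ary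 graph $\mathcal{E}$ on $\mathbb{F}_q^v$ is a $q$-ary divisible design graph ($q$-DDG) with respect to $\mathcal{G}$ with parameters $(v,k,\lambda_1,\lambda_2,n;q)$ if for all vertices $X\neq Y$ the number $|(N_{\mathcal{E}}(X)\cap N_{\mathcal{E}}(Y))\setminus\{X,Y\}|$ equals $\lambda_1$ if some $G\in\mathcal{G}$ contains both $X$ and $Y$, and equals $\lambda_2$ otherwise. *)

theory Defs
  imports "HOL-Analysis.Analysis" "HOL-Number_Theory.Prime_Powers"
begin

(* The ambient space F_q^v is the type 'f ^ 'd with 'f a finite field, q = CARD('f) and
   v = CARD('d). Linear notions are those of the library interpretation "vec", i.e. with
   scalars in 'f. *)

definition subspaces_of_dim :: "nat \<Rightarrow> ('f::{field,finite} ^ 'd) set set" where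
  "subspaces_of_dim d = {S. vec.subspace S \<and> vec.dim S = d}"

(* The vertex set of a q-ary graph is always subspaces_of_dim 1, so a q-ary graph is given
   by its edge set. *)

definition q_ary_graph :: "('f::{field,finite} ^ 'd) set set \<Rightarrow> bool" where
  "q_ary_graph E \<longleftrightarrow> E \<subseteq> subspaces_of_dim 2"

definition adjacent ::
  "('f::{field,finite} ^ 'd) set set \<Rightarrow> ('f ^ 'd) set \<Rightarrow> ('f ^ 'd) set \<Rightarrow> bool" where
  "adjacent E X Y \<longleftrightarrow>
     X \<in> subspaces_of_dim 1 \<and> Y \<in> subspaces_of_dim 1 \<and> X \<noteq> Y \<and> vec.span (X \<union> Y) \<in> E"

definition neighborhood ::
  "('f::{field,finite} ^ 'd) set set \<Rightarrow> ('f ^ 'd) set \<Rightarrow> ('f ^ 'd) set set" where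
  "neighborhood E X = insert X {Y. adjacent E X Y}"

definition regular_graph :: "nat \<Rightarrow> ('f::{field,finite} ^ 'd) set set \<Rightarrow> bool" where
  "regular_graph k E \<longleftrightarrow> q_ary_graph E \<and>
     (\<forall>X \<in> subspaces_of_dim 1. \<exists>U \<in> subspaces_of_dim (k + 1).
        neighborhood E X = {Y \<in> subspaces_of_dim 1. Y \<subseteq> U})"

definition spread :: "nat \<Rightarrow> ('f::{field,finite} ^ 'd) set set \<Rightarrow> bool" where
  "spread n \<G> \<longleftrightarrow> \<G> \<subseteq> subspaces_of_dim n \<and> (\<forall>x. x \<noteq> 0 \<longrightarrow> (\<exists>!S. S \<in> \<G> \<and> x \<in> S))"

(* The parameters v and q of a q-DDG are determined by the type of E. *)

definition q_DDG ::
  "nat \<Rightarrow> nat \<Rightarrow> nat \<Rightarrow> nat \<Rightarrow>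
   ('f::{field,finite} ^ 'd) set set \<Rightarrow> ('f ^ 'd) set set \<Rightarrow> bool" where
  "q_DDG k l1 l2 n \<G> E \<longleftrightarrow> spread n \<G> \<and> regular_graph k E \<and>
     (\<forall>X \<in> subspaces_of_dim 1. \<forall>Y \<in> subspaces_of_dim 1. X \<noteq> Y \<longrightarrow>
        card ((neighborhood E X \<inter> neighborhood E Y) - {X, Y}) =
          (if \<exists>G \<in> \<G>. X \<subseteq> G \<and> Y \<subseteq> G then l1 else l2))"

definition complete_graph :: "('f::{field,finite} ^ 'd) set set" where
  "complete_graph = subspaces_of_dim 2"

definition union_of_complete_graphs ::
  "('f::{field,finite} ^ 'd) set set \<Rightarrow> ('f ^ 'd) set set" where
  "union_of_complete_graphs \<G> = {L \<in> subspaces_of_dim 2. \<exists>G \<in> \<G>. L \<subseteq> G}"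

definition empty_graph :: "('f::{field,finite} ^ 'd) set set" where
  "empty_graph = {}"

end

theory Submission
  imports Defs "HOL-Number_Theory.Cong"
begin

text \<open>
  For a vertex \<open>X\<close> let \<open>U\<^sub>X\<close> be the subspace of dimension \<open>m = k + 1\<close> whose points form the
  neighborhood of \<open>X\<close>. If \<open>X \<noteq> Y\<close>, then \<open>U\<^sub>X \<inter> U\<^sub>Y\<close> is again a subspace, and its points are the
  common neighbors of \<open>X\<close> and \<open>Y\<close>, together with \<open>X\<close> and \<open>Y\<close> themselves exactly when these are
  adjacent. So the number of common neighbors is \<open>[d]\<close> for a non-adjacent pair and \<open>[d] - 2\<close>
  for an adjacent pair, where \<open>[d] = (q\<^sup>d - 1) / (q - 1)\<close>. Two Gaussian numbers differ by \<open>2\<close> only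
  for \<open>q = 2\<close>, as \<open>3 = 1 + 2\<close>. Hence, unless \<open>q = 2\<close> and \<open>\<lambda>\<^sub>1 = 1\<close>, either all or none of the pairs
  inside spread elements are adjacent, and unless \<open>q = 2\<close> and \<open>\<lambda>\<^sub>2 = 1\<close> the same holds for the pairs
  that lie in two different spread elements.

  When both kinds of pairs are uniform, the graph is empty, complete or the union of complete
  graphs: the remaining combination, adjacency exactly between different spread elements, cannot
  occur, because the complement of a proper subspace spans the whole space, which forces
  \<open>U\<^sub>X\<close> to be everything.

  The exceptional cases over the field with two elements are settled by counting the paths of
  length two that start at a vertex, which gives
  \<open>(2\<^sup>m - 2) (2\<^sup>m - 3) = (2\<^sup>n - 2) \<lambda>\<^sub>1 + (2\<^sup>v - 2\<^sup>n) \<lambda>\<^sub>2\<close>.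
  If \<open>\<lambda>\<^sub>2 = 1\<close> and the adjacency inside spread elements is uniform with \<open>\<lambda>\<^sub>1 \<noteq> 1\<close>, the equation fails
  by size or modulo 8 when no such pair is adjacent; when all are adjacent it forces \<open>n = 2\<close> and
  \<open>v = 5\<close>, where no spread exists because 3 does not divide 31. If \<open>\<lambda>\<^sub>1 = \<lambda>\<^sub>2 = 1\<close>, or if
  \<open>\<lambda>\<^sub>1 = 1\<close> and different spread elements are not joined, then the whole graph, respectively its
  restriction to a spread element, is a regular graph in which any two vertices have exactly one
  common neighbor. The equation leaves only the triangle and degree 6 on 31 vertices. A triangle
  is too small for the whole graph, since \<open>v > 2\<close>; as a spread element it has \<open>n = 2\<close> and all its
  pairs adjacent, so the graph is the union of complete graphs. The other case is excluded as in
  the friendship theorem: the closed walks of length five are permuted freely by rotation, so 5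
  divides their number, but that number is congruent to \<open>31 \<cdot> 6\<^sup>3\<close> modulo 5.
\<close>

section \<open>Graphs with unique common neighbors\<close>

text \<open>
  The cyclic group generated by \<open>f\<close> has prime order, so it has no orbits except fixed points and
  orbits of length \<open>p\<close>.
\<close>

lemma prime_dvd_card_if_no_fixed_point:
  fixes f :: "'a \<Rightarrow> 'a" and p :: nat
  assumes "finite A" "prime p"
    and maps: "\<And>x. x \<in> A \<Longrightarrow> f x \<in> A"
    and period: "\<And>x. x \<in> A \<Longrightarrow> (f ^^ p) x = x"
    and free: "\<And>x. x \<in> A \<Longrightarrow> f x \<noteq> x"
  shows "p dvd card A"
proof -
  define orb where "orb x = (\<lambda>i. (f ^^ i) x) ` {..<p}" for x
  have p0: "p > 0" using \<open>prime p\<close> by (simp add: prime_gt_0_nat)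
  have orb_iff: "z \<in> orb x \<longleftrightarrow> (\<exists>i. z = (f ^^ i) x)" if "x \<in> A" for x z
  proof
    assume "\<exists>i. z = (f ^^ i) x"
    then obtain i where "z = (f ^^ i) x" by blast
    then have "z = (f ^^ (i mod p)) x"
      using funpow_mod_eq[OF period[OF that], of i] by simp
    then show "z \<in> orb x" unfolding orb_def using p0 by auto
  qed (auto simp: orb_def)
  have orb_A: "z \<in> A" if "x \<in> A" "z \<in> orb x" for x z
  proof -
    have "(f ^^ i) x \<in> A" for i by (induction i) (use that maps in auto)
    then show ?thesis using that by (auto simp: orb_def)
  qed
  have no_fix: "(f ^^ d) x \<noteq> x" if x: "x \<in> A" and d: "0 < d" "d < p" for x d
  proof
    assume fix_d: "(f ^^ d) x = x"
    have "coprime d p"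
      using d \<open>prime p\<close> by (metis coprime_commute nat_dvd_not_less prime_imp_coprime)
    then obtain e where e: "[d * e = 1] (mod p)"
      using cong_solve_coprime_nat by (metis One_nat_def)
    have "(f ^^ (d * e)) x = ((f ^^ d) ^^ e) x"
      by (simp add: funpow_mult)
    also have "\<dots> = x" by (induction e) (use fix_d in auto)
    finally have "(f ^^ (1 mod p)) x = x"
      using e funpow_mod_eq[OF period[OF x], of "d * e"] by (simp add: cong_def)
    moreover have "1 mod p = 1" using prime_gt_1_nat[OF \<open>prime p\<close>] by simp
    ultimately show False using free[OF x] by simp
  qed
  have card_orb: "card (orb x) = p" if x: "x \<in> A" for x
  proof -
    have "i = j" if "i \<le> j" "j < p" "(f ^^ i) x = (f ^^ j) x" for i j
    proof (rule ccontr)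
      assume "i \<noteq> j"
      have "(f ^^ (p - i + j)) x = (f ^^ (p - i)) ((f ^^ j) x)"
        by (simp add: funpow_add)
      also have "\<dots> = (f ^^ (p - i + i)) x"
        using that(3) by (simp only: funpow_add o_apply)
      also have "\<dots> = x" using that period[OF x] by simp
      finally have "(f ^^ ((p - i + j) mod p)) x = x"
        using funpow_mod_eq[OF period[OF x]] by metis
      moreover have "p - i + j = (j - i) + p" using that by simp
      then have "(p - i + j) mod p = (j - i) mod p" by (metis mod_add_self2)
      then have "(p - i + j) mod p = j - i" using that by simp
      ultimately show False using no_fix[OF x, of "j - i"] that \<open>i \<noteq> j\<close> by simp
    qed
    then have "inj_on (\<lambda>i. (f ^^ i) x) {..<p}"
      by (intro inj_onI) (metis lessThan_iff linorder_le_cases)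
    then show ?thesis by (simp add: orb_def card_image)
  qed
  have orb_eq: "orb z = orb x" if x: "x \<in> A" and z: "z \<in> orb x" for x z
  proof -
    have zA: "z \<in> A" using orb_A[OF x z] .
    obtain i where i: "z = (f ^^ i) x" "i < p" using z by (auto simp: orb_def)
    have "x = (f ^^ (p - i)) z"
      using i period[OF x] by (metis funpow_add le_add_diff_inverse2 less_imp_le o_apply)
    then show ?thesis
      unfolding set_eq_iff orb_iff[OF x] orb_iff[OF zA] using i(1)
      by (metis funpow_add o_apply)
  qed
  have "\<Union> (orb ` A) = A"
  proof -
    have "x \<in> orb x" if "x \<in> A" for x
      using orb_iff[OF that, of x] funpow_0 by metis
    then show ?thesis using orb_A by blast
  qed
  moreover have "p dvd card (\<Union> (orb ` A))"
  proof (rule dvd_partition)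
    show "finite (\<Union> (orb ` A))" using calculation \<open>finite A\<close> by simp
    show "\<forall>c\<in>orb ` A. p dvd card c" using card_orb by auto
    show "\<forall>c1\<in>orb ` A. \<forall>c2\<in>orb ` A. c1 \<noteq> c2 \<longrightarrow> c1 \<inter> c2 = {}"
      using orb_eq by blast
  qed
  ultimately show ?thesis by simp
qed

text \<open>
  Closed walks of length five are counted twice. Rotation permutes them without fixed points,
  since a fixed walk would be a loop. On the other hand a walk \<open>a, b, c, d\<close> closes up through
  one common neighbor of \<open>d\<close> and \<open>a\<close> if these differ, and through \<open>5 j + 1\<close> vertices if they agree,
  hence always through one vertex modulo 5.
\<close>

lemma friendship_graph_dvd:
  fixes N :: "'a \<Rightarrow> 'a set"
  assumes "finite S" and N: "\<And>x. x \<in> S \<Longrightarrow> N x \<subseteq> S"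
    and sym: "\<And>x y. x \<in> S \<Longrightarrow> y \<in> N x \<Longrightarrow> x \<in> N y"
    and irrefl: "\<And>x. x \<in> S \<Longrightarrow> x \<notin> N x"
    and deg: "\<And>x. x \<in> S \<Longrightarrow> card (N x) = 5 * j + 1"
    and common: "\<And>x y. x \<in> S \<Longrightarrow> y \<in> S \<Longrightarrow> x \<noteq> y \<Longrightarrow> card (N x \<inter> N y) = 1"
  shows "5 dvd card S"
proof -
  define W where "W = (SIGMA a:S. SIGMA b:N a. SIGMA c:N b. SIGMA d:N c. N d \<inter> N a)"
  define r :: "'a \<times> 'a \<times> 'a \<times> 'a \<times> 'a \<Rightarrow> _"
    where "r = (\<lambda>(a, b, c, d, e). (b, c, d, e, a))"
  have fin: "finite (N x)" if "x \<in> S" for x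
    using N[OF that] \<open>finite S\<close> finite_subset by blast
  have NS: "y \<in> S" if "x \<in> S" "y \<in> N x" for x y
    using N that by blast
  have finW: "finite W"
    unfolding W_def using \<open>finite S\<close> by (intro finite_SigmaI) (meson fin NS finite_Int)+
  have "5 dvd card W"
  proof (rule prime_dvd_card_if_no_fixed_point[where f = r])
    show "finite W" by (fact finW)
    show "prime (5::nat)" by simp
    fix w assume "w \<in> W"
    then obtain a b c d e where w: "w = (a, b, c, d, e)"
      and walk: "a \<in> S" "b \<in> N a" "c \<in> N b" "d \<in> N c" "e \<in> N d" "e \<in> N a"
      by (auto simp: W_def)
    moreover have S: "b \<in> S" "c \<in> S" "d \<in> S" "e \<in> S" using N walk by blast+
    ultimately have "a \<in> N e" "a \<in> N b" using sym by blast+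
    show "r w \<in> W" using walk S \<open>a \<in> N e\<close> \<open>a \<in> N b\<close> by (simp add: w r_def W_def)
    show "(r ^^ 5) w = w" by (simp add: w r_def numeral_eq_Suc)
    show "r w \<noteq> w" using walk irrefl by (auto simp: w r_def)
  qed
  moreover have "card W = (5 * j + 1) ^ 3 * card S
    + 5 * (j * (\<Sum>a\<in>S. \<Sum>b\<in>N a. \<Sum>c\<in>N b. \<Sum>d\<in>N c. if d = a then 1 else 0))"
  proof -
    have last: "card (N d \<inter> N a) = 1 + 5 * j * (if d = a then 1 else 0)"
      if "a \<in> S" "d \<in> S" for a d
      using deg[OF that(1)] common[OF that(2,1)] by auto
    have f1: "finite (SIGMA d:N c. N d \<inter> N a)" if "a \<in> S" "c \<in> S" for a c
      by (intro finite_SigmaI) (meson that fin NS finite_Int)+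
    have f2: "finite (SIGMA c:N b. SIGMA d:N c. N d \<inter> N a)" if "a \<in> S" "b \<in> S" for a b
      by (intro finite_SigmaI f1) (meson that fin NS)+
    have f3: "finite (SIGMA b:N a. SIGMA c:N b. SIGMA d:N c. N d \<inter> N a)" if "a \<in> S" for a
      by (intro finite_SigmaI f2) (meson that fin NS)+
    have c1: "card (SIGMA d:N c. N d \<inter> N a) = (\<Sum>d\<in>N c. card (N d \<inter> N a))"
      if "a \<in> S" "c \<in> S" for a c
      by (rule card_SigmaI) (meson that fin NS finite_Int)+
    have c2: "card (SIGMA c:N b. SIGMA d:N c. N d \<inter> N a)
        = (\<Sum>c\<in>N b. \<Sum>d\<in>N c. card (N d \<inter> N a))" if "a \<in> S" "b \<in> S" for a b
    proof -
      have "card (SIGMA c:N b. SIGMA d:N c. N d \<inter> N a)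
          = (\<Sum>c\<in>N b. card (SIGMA d:N c. N d \<inter> N a))"
        by (rule card_SigmaI) (use that fin f1[OF that(1) NS[OF that(2)]] in auto)
      also have "\<dots> = (\<Sum>c\<in>N b. \<Sum>d\<in>N c. card (N d \<inter> N a))"
        by (rule sum.cong[OF refl], rule c1) (meson that NS)+
      finally show ?thesis .
    qed
    have c3: "card (SIGMA b:N a. SIGMA c:N b. SIGMA d:N c. N d \<inter> N a)
        = (\<Sum>b\<in>N a. \<Sum>c\<in>N b. \<Sum>d\<in>N c. card (N d \<inter> N a))" if "a \<in> S" for a
    proof -
      have "card (SIGMA b:N a. SIGMA c:N b. SIGMA d:N c. N d \<inter> N a)
          = (\<Sum>b\<in>N a. card (SIGMA c:N b. SIGMA d:N c. N d \<inter> N a))"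
        by (rule card_SigmaI) (use that fin f2[OF that NS[OF that]] in auto)
      also have "\<dots> = (\<Sum>b\<in>N a. \<Sum>c\<in>N b. \<Sum>d\<in>N c. card (N d \<inter> N a))"
        by (rule sum.cong[OF refl], rule c2) (meson that NS)+
      finally show ?thesis .
    qed
    have "card W = (\<Sum>a\<in>S. card (SIGMA b:N a. SIGMA c:N b. SIGMA d:N c. N d \<inter> N a))"
      unfolding W_def by (rule card_SigmaI) (use \<open>finite S\<close> f3 in auto)
    also have "\<dots> = (\<Sum>a\<in>S. \<Sum>b\<in>N a. \<Sum>c\<in>N b. \<Sum>d\<in>N c. card (N d \<inter> N a))"
      by (rule sum.cong[OF refl], rule c3)
    also have "\<dots> = (\<Sum>a\<in>S. \<Sum>b\<in>N a. \<Sum>c\<in>N b. \<Sum>d\<in>N c. 1 + 5 * j * (if d = a then 1 else 0))"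
      by (intro sum.cong refl last) (blast intro: NS)+
    also have "\<dots> = (\<Sum>a\<in>S. \<Sum>b\<in>N a. \<Sum>c\<in>N b. \<Sum>d\<in>N c. 1)
        + 5 * (j * (\<Sum>a\<in>S. \<Sum>b\<in>N a. \<Sum>c\<in>N b. \<Sum>d\<in>N c. if d = a then 1 else 0))"
      by (simp only: sum.distrib sum_distrib_left mult.assoc)
    also have "(\<Sum>a\<in>S. \<Sum>b\<in>N a. \<Sum>c\<in>N b. \<Sum>d\<in>N c. (1::nat)) = (5 * j + 1) ^ 3 * card S"
    proof -
      have "(\<Sum>c\<in>N b. \<Sum>d\<in>N c. (1::nat)) = (5 * j + 1) ^ 2" if "b \<in> S" for b
        using N[OF that] deg that by (simp add: power2_eq_square subset_iff)
      then have "(\<Sum>b\<in>N a. \<Sum>c\<in>N b. \<Sum>d\<in>N c. (1::nat)) = (5 * j + 1) ^ 3" if "a \<in> S" for a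
        using N[OF that] deg that by (simp add: power3_eq_cube power2_eq_square subset_iff)
      then show ?thesis by simp
    qed
    finally show ?thesis .
  qed
  ultimately have "5 dvd (5 * j + 1) ^ 3 * card S + 5 * (j *
      (\<Sum>a\<in>S. \<Sum>b\<in>N a. \<Sum>c\<in>N b. \<Sum>d\<in>N c. if d = a then 1 else 0))"
    by (simp only:)
  then have "5 dvd (5 * j + 1) ^ 3 * card S"
    by (rule dvd_add_left_iff[THEN iffD1, OF dvd_triv_left])
  moreover have "prime (5::nat)" by simp
  moreover have "\<not> 5 dvd 5 * j + 1" by presburger
  ultimately show ?thesis by (metis prime_dvd_mult_nat prime_dvd_power_nat)
qed

text \<open>
  Both sides count the paths \<open>x, z, y\<close> of length two with \<open>y \<noteq> x\<close>.
\<close>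

lemma sum_card_common_neighbors:
  fixes N :: "'a \<Rightarrow> 'a set"
  assumes "finite S" and N: "\<And>x. x \<in> S \<Longrightarrow> N x \<subseteq> S"
    and sym: "\<And>x y. x \<in> S \<Longrightarrow> y \<in> N x \<Longrightarrow> x \<in> N y"
    and deg: "\<And>x. x \<in> S \<Longrightarrow> card (N x) = K"
    and x: "x \<in> S"
  shows "(\<Sum>y\<in>S - {x}. card (N x \<inter> N y)) = K * (K - 1)"
proof -
  have fin: "finite (N x)" if "x \<in> S" for x
    using N[OF that] \<open>finite S\<close> finite_subset by blast
  have "(\<Sum>y\<in>S - {x}. card {z \<in> N x. z \<in> N y}) = (\<Sum>z\<in>N x. card {y \<in> S - {x}. z \<in> N y})"
    by (rule sum_multicount_gen) (use assms fin in auto)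
  also have "\<dots> = (\<Sum>z\<in>N x. K - 1)"
  proof (rule sum.cong[OF refl])
    fix z assume z: "z \<in> N x"
    then have "{y \<in> S - {x}. z \<in> N y} = N z - {x}" "x \<in> N z" "z \<in> S"
      using N sym x by blast+
    then show "card {y \<in> S - {x}. z \<in> N y} = K - 1"
      using deg fin by (simp add: card_Diff_singleton)
  qed
  finally show ?thesis using deg[OF x] by (simp add: Int_def)
qed

section \<open>The arithmetic of the counting equations\<close>

text \<open>
  The numbers \<open>a\<close> and \<open>b\<close> are the Gaussian numbers \<open>[d]\<close> and \<open>[e]\<close>. Their difference is at least
  \<open>q\<^sup>e\<close>, which leaves \<open>e = 0\<close>, impossible because \<open>q\<^sup>d + 1 = 2 q\<close> makes \<open>q\<close> a unit, and
  \<open>q = 2\<close> with \<open>e = 1\<close>.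
\<close>

lemma gauss_number_difference_two:
  fixes q a b d e :: nat
  assumes q: "2 \<le> q"
    and a: "a * (q - 1) + 1 = q ^ d" and b: "b * (q - 1) + 1 = q ^ e" and ab: "a = b + 2"
  shows "q = 2 \<and> b = 1"
proof -
  define r where "r = q - 1"
  have r: "q = r + 1" "1 \<le> r" using q by (simp_all add: r_def)
  have eq: "q ^ d = q ^ e + 2 * r" using a b r ab by (simp add: algebra_simps)
  have lt: "e < d"
  proof (rule ccontr)
    assume "\<not> e < d"
    then have "q ^ d \<le> q ^ e" using q by (intro power_increasing) auto
    then show False using eq r(2) by linarith
  qed
  then have "q * q ^ e \<le> q ^ d"
    using q power_increasing[of "Suc e" d q] by simp
  then have "r * q ^ e \<le> r * 2" using eq r by (simp add: algebra_simps)
  then have le: "q ^ e \<le> 2" using r by simp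
  show ?thesis
  proof (cases e)
    case 0
    moreover have "q dvd q ^ d" using lt by (simp add: dvd_power)
    moreover have "q ^ d + 1 = 2 * q" using eq r 0 by simp
    ultimately have "q dvd 1" by (metis dvd_add_right_iff dvd_triv_right)
    then show ?thesis using q by simp
  next
    case (Suc e')
    have "q \<le> q ^ e" using Suc q by simp
    then have "q = 2" using le q by simp
    moreover have "q ^ e = 2" using le q \<open>q \<le> q ^ e\<close> by linarith
    ultimately show ?thesis using b by simp
  qed
qed

text \<open>
  For \<open>m \<ge> 4\<close> the equation gives \<open>2 ^ w = 8\<close> modulo 16, hence \<open>w = 3\<close>, which is too small; the
  few remaining \<open>m\<close> are inspected one by one.
\<close>

lemma friendship_equation:
  fixes m w :: nat
  assumes eq: "(2 ^ m - 2) * (2 ^ m - 3) = (2 ^ w - 2 :: nat)" and w: "2 \<le> w"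
  shows "m = 2 \<and> w = 2 \<or> m = 3 \<and> w = 5"
proof -
  have W: "(2::nat) ^ w = (2 ^ m - 2) * (2 ^ m - 3) + 2"
    using eq power_increasing[OF w, of "2::nat"] by simp
  consider "m \<le> 1" | "m = 2" | "m = 3" | "4 \<le> m" by linarith
  then show ?thesis
  proof cases
    case 1
    then have "m = 0 \<or> m = 1" by auto
    then have "(2::nat) ^ w = 2" using W by auto
    then show ?thesis using power_increasing[OF w, of "2::nat"] by simp
  next
    case 2
    then have "(2::nat) ^ w = 2 ^ 2" using W by simp
    then have "w = 2" by (rule power_inject_exp[THEN iffD1, rotated]) simp
    then show ?thesis using 2 by simp
  next
    case 3
    then have "(2::nat) ^ w = 2 ^ 5" using W by simp
    then have "w = 5" by (rule power_inject_exp[THEN iffD1, rotated]) simp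
    then show ?thesis using 3 by simp
  next
    case 4
    then obtain j where j: "m = 4 + j" by (metis le_Suc_ex)
    define t :: nat where "t = 2 ^ j"
    have t: "t \<ge> 1" by (simp add: t_def)
    have m16: "2 ^ m = 16 * t" by (simp add: j t_def power_add)
    have "(16 * t - 2) * (16 * t - 3) + 80 * t = 256 * t * t + (6::nat)"
    proof -
      obtain s where "t = s + 1" using t by (metis add.commute le_Suc_ex)
      then show ?thesis by (simp add: algebra_simps)
    qed
    then have W': "2 ^ w + 80 * t = 256 * t * t + (8::nat)" using W m16 by simp
    then have "2 ^ w + 16 * (5 * t) = 8 + 16 * (16 * (t * t))" by simp
    then have "(2 ^ w + 16 * (5 * t)) mod 16 = (8 + 16 * (16 * (t * t))) mod 16" by (rule arg_cong)
    then have mod: "(2::nat) ^ w mod 16 = 8" by (simp only: mod_mult_self2) simp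
    have "w = 3"
    proof (rule ccontr)
      assume "w \<noteq> 3"
      then have "w = 2 \<or> 4 \<le> w" using w by linarith
      then show False
      proof
        assume "4 \<le> w"
        then have "(2::nat) ^ 4 dvd 2 ^ w" by (rule le_imp_power_dvd)
        then show False using mod by simp
      qed (use mod in simp)
    qed
    then have "5 * t = 16 * t * t" using W' by simp
    then show ?thesis using t by simp
  qed
qed

text \<open>
  Write \<open>m = n + j\<close> and \<open>v = n + 1 + i\<close> and divide by \<open>2 ^ n\<close>. Parity then forces \<open>j > 0\<close> and exactly
  one of \<open>j = 1\<close> and \<open>i = 0\<close>. The second is excluded by size, and the first by divisibility unless
  \<open>n = 2\<close>.
\<close>

lemma within_complete_equation:
  fixes m n v :: nat
  assumes eq: "(2 ^ m - 2) * (2 ^ m - 3) = (2 ^ n - 2) * (2 ^ n - 3) + (2 ^ v - 2 ^ n :: nat)"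
    and n: "2 \<le> n" "n < v" "n \<le> m"
  shows "n = 2 \<and> v = 5"
proof -
  obtain j where j: "m = n + j" using n(3) le_Suc_ex by blast
  obtain i where i: "v = n + Suc i" using n(2) less_imp_Suc_add by auto
  obtain n' where n': "n = Suc (Suc n')" using n(1) by (metis Suc_le_D numeral_2_eq_2 Suc_le_mono)
  define Q :: int where "Q = 2 ^ n"
  define J :: int where "J = 2 ^ j"
  define I :: int where "I = 2 ^ i"
  have Q4: "Q = 4 * 2 ^ n'" by (simp add: Q_def n')
  have Q: "Q \<ge> 4" by (simp add: Q4)
  have "int ((2 ^ m - 2) * (2 ^ m - 3)) = (2 ^ m - 2) * (2 ^ m - 3)"
    using power_increasing[of 2 m "2::nat"] n by (simp add: of_nat_diff)
  moreover have "int ((2 ^ n - 2) * (2 ^ n - 3)) = (2 ^ n - 2) * (2 ^ n - 3)"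
    using power_increasing[of 2 n "2::nat"] n by (simp add: of_nat_diff)
  moreover have "int (2 ^ v - 2 ^ n) = 2 ^ v - 2 ^ n"
    using n by (simp add: of_nat_diff power_increasing)
  ultimately have "(2 ^ m - 2) * (2 ^ m - 3) = (2 ^ n - 2) * (2 ^ n - 3) + (2 ^ v - 2 ^ n :: int)"
    using eq by (metis of_nat_add)
  then have "Q * (Q * J ^ 2 + 6) = Q * (Q + 2 * I + 5 * J)"
    by (simp add: j i power_add Q_def J_def I_def algebra_simps power2_eq_square)
  then have main: "Q * J ^ 2 + 6 = Q + 2 * I + 5 * J" using Q by simp
  show ?thesis
  proof (cases j)
    case 0
    then show ?thesis using main by (simp add: J_def I_def) presburger
  next
    case (Suc j')
    define H :: int where "H = 2 ^ j'"
    have J: "J = 2 * H" by (simp add: J_def H_def Suc)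
    have "2 * (Q * H\<^sup>2) + 3 = 2 * 2 ^ n' + I + 5 * H"
      using main by (simp add: J Q4 power2_eq_square)
    then have par: "odd (I + 5 * H)" by presburger
    show ?thesis
    proof (cases j')
      case 0
      then have H: "H = 1" by (simp add: H_def)
      then have I: "3 * Q = 2 * I + 4" using main J by simp
      show ?thesis
      proof (cases n')
        case 0
        then have "I = 2 ^ 2" using I Q4 by simp
        then have "i = 2" unfolding I_def by (rule power_inject_exp[THEN iffD1, rotated]) simp
        then show ?thesis using i n' 0 by simp
      next
        case (Suc n'')
        then have "6 * 2 ^ Suc n'' = I + 2" using I Q4 by simp
        then have *: "12 * 2 ^ n'' = I + 2" by simp
        consider "i = 0" | "i = 1" | "2 \<le> i" by linarith
        then show ?thesis
        proof cases
          case 3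
          then obtain i' where "i = Suc (Suc i')" by (metis Suc_le_D Suc_le_mono numeral_2_eq_2)
          then have "12 * 2 ^ n'' = 4 * 2 ^ i' + (2::int)" using * by (simp add: I_def)
          then show ?thesis by presburger
        qed (use * in \<open>simp_all add: I_def\<close>, presburger+)
      qed
    next
      case (Suc j'')
      then have H2: "H = 2 * 2 ^ j''" by (simp add: H_def)
      then have "odd I" using par by simp
      then have I: "I = 1" unfolding I_def by (cases i) auto
      have "H \<ge> 2" by (simp add: H2)
      then have "J \<ge> 4" by (simp add: J)
      have "Q * (J\<^sup>2 - 1) = 5 * J - 4" using main I by (simp add: algebra_simps)
      moreover have "4 * (J\<^sup>2 - 1) \<le> Q * (J\<^sup>2 - 1)"
        using Q \<open>J \<ge> 4\<close> by (intro mult_right_mono) (auto simp: power2_eq_square intro: order_trans[OF _ mult_mono[of 1 J 1 J]])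
      ultimately have "4 * J\<^sup>2 \<le> 5 * J" by (simp only:) simp
      moreover have "4 * J \<le> J\<^sup>2" using \<open>J \<ge> 4\<close> by (simp add: power2_eq_square mult_right_mono)
      ultimately have False using \<open>J \<ge> 4\<close> by linarith
      then show ?thesis ..
    qed
  qed
qed

text \<open>
  If \<open>l \<noteq> 1\<close>, then \<open>l\<close> is \<open>0\<close> or congruent to 3 modulo 4. The right-hand side exceeds the
  values of the left-hand side for \<open>m \<le> 2\<close>, and for \<open>m \<ge> 3\<close> the two sides differ modulo 8.
\<close>

lemma within_empty_equation:
  fixes m n v d l :: nat
  assumes eq: "(2 ^ m - 2) * (2 ^ m - 3) = (2 ^ n - 2) * l + (2 ^ v - 2 ^ n)"
    and n: "2 \<le> n" "n < v" and l: "l + 1 = 2 ^ d"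
  shows "l = 1"
proof (rule ccontr)
  assume "l \<noteq> 1"
  then have d: "d \<noteq> 1" using l by auto
  have "(2::nat) ^ Suc n \<le> 2 ^ v" using n by (intro power_increasing) auto
  then have big: "2 ^ v - 2 ^ n \<ge> (2::nat) ^ n" by simp
  moreover have n4: "(2::nat) ^ n \<ge> 2 ^ 2" using n by (intro power_increasing) auto
  ultimately have rhs: "(2 ^ m - 2) * (2 ^ m - 3) \<ge> (4::nat)" using eq by simp
  have m3: "3 \<le> m"
  proof (rule ccontr)
    assume "\<not> 3 \<le> m"
    then have "m = 0 \<or> m = 1 \<or> m = 2" by auto
    then show False using rhs by auto
  qed
  obtain M where M: "(2::nat) ^ m = 8 * M" "M \<ge> 1"
    proof -
    from le_imp_power_dvd[OF m3, of "2::nat"] obtain M where M: "(2::nat) ^ m = 8 * M" by (auto elim!: dvdE)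
    moreover have "M \<ge> 1" using M by (cases M) auto
    ultimately show ?thesis using that by blast
  qed
  obtain P where P: "(2::nat) ^ n = 4 * P" "P \<ge> 1"
    using le_imp_power_dvd[OF n(1), of "2::nat"] n4 by (auto elim!: dvdE)
  have "3 \<le> v" using n by simp
  from le_imp_power_dvd[OF this, of "2::nat"] obtain R where R: "(2::nat) ^ v = 8 * R" by (auto elim!: dvdE)
  have PR: "4 * P \<le> 8 * R" using P R big by (metis less_imp_le n(2) one_le_numeral power_increasing)
  obtain M' where M': "M = M' + 1" using M(2) by (metis add.commute le_Suc_ex)
  obtain P' where P': "P = P' + 1" using P(2) by (metis add.commute le_Suc_ex)
  have e: "(8 * M - 2) * (8 * M - 3) = (4 * P - 2) * l + (8 * R - 4 * P)" using eq M P R by simp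
  have "(8 * M - 2) * (8 * M - 3) = 8 * (8 * (M' * M') + 11 * M' + 3) + 6"
    by (simp add: M' algebra_simps)
  moreover have "(4 * P - 2) * l = 4 * (P' * l) + 2 * l" by (simp add: P' algebra_simps)
  moreover define X where "X = 8 * (M' * M') + 11 * M' + 3"
  ultimately have key: "8 * X + 10 + 4 * P' = 4 * (P' * l) + 2 * l + 8 * R"
    using e PR P' by simp
  consider "d = 0" | "2 \<le> d" using d by linarith
  then show False
  proof cases
    case 1
    then have "l = 0" using l by simp
    then have "8 * X + 10 + 4 * P' = 8 * R" using key by simp
    then show False by presburger
  next
    case 2
    from le_imp_power_dvd[OF this, of "2::nat"] obtain D where D: "l + 1 = 4 * D" using l by (auto elim!: dvdE)
    then obtain D' where D': "l = 4 * D' + 3" by (cases D) auto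
    define Y where "Y = P' * D'"
    have "4 * (P' * l) = 16 * Y + 12 * P'" by (simp add: D' Y_def algebra_simps)
    then have "8 * X + 10 + 4 * P' = 16 * Y + 12 * P' + 8 * D' + 6 + 8 * R" using key D' by simp
    then show False by presburger
  qed
qed

section \<open>Counting points of subspaces over finite fields\<close>

text \<open>
  Adjoining a vector \<open>a\<close> outside the span of \<open>B\<close> multiplies the number of vectors by \<open>q\<close>, because
  \<open>c *s a + s\<close> determines \<open>c\<close> and \<open>s\<close>.
\<close>

lemma card_subspace:
  fixes S :: "('f::{field,finite} ^ 'd) set"
  assumes "vec.subspace S"
  shows "card S = CARD('f) ^ vec.dim S"
proof -
  have span: "card (vec.span B) = CARD('f) ^ card B" if "finite B" "vec.independent B"
    for B :: "('f ^ 'd) set"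
    using that
  proof (induction B rule: finite_induct)
    case (insert a B)
    then have a: "a \<notin> vec.span B" and B: "vec.independent B"
      by (auto simp: vec.independent_insert)
    define h where "h = (\<lambda>(c, s). c *s a + s)"
    have "bij_betw h (UNIV \<times> vec.span B) (vec.span (insert a B))"
    proof (rule bij_betw_imageI)
      show "inj_on h (UNIV \<times> vec.span B)"
      proof (rule inj_onI, clarsimp simp: h_def)
        fix c s c' s'
        assume s: "s \<in> vec.span B" "s' \<in> vec.span B" and eq: "c *s a + s = c' *s a + s'"
        then have "(c - c') *s a = s' - s"
          by (simp add: vec.scale_left_diff_distrib algebra_simps)
        then have "(c - c') *s a \<in> vec.span B" using s by (simp add: vec.span_diff)
        then have "inverse (c - c') *s ((c - c') *s a) \<in> vec.span B"
          by (rule vec.span_scale)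
        moreover have "inverse (c - c') *s ((c - c') *s a) = a" if "c \<noteq> c'"
          using that by (simp only: vec.scale_scale) simp
        ultimately have "c = c'" using a by metis
        then show "c = c' \<and> s = s'" using eq by simp
      qed
      show "h ` (UNIV \<times> vec.span B) = vec.span (insert a B)"
      proof safe
        fix c s assume "s \<in> vec.span B"
        then show "h (c, s) \<in> vec.span (insert a B)"
          unfolding h_def vec.span_insert by (auto intro: exI[of _ c])
      next
        fix x assume "x \<in> vec.span (insert a B)"
        then obtain c where "x - c *s a \<in> vec.span B" unfolding vec.span_insert by blast
        moreover have "x = h (c, x - c *s a)" by (simp add: h_def)
        ultimately show "x \<in> h ` (UNIV \<times> vec.span B)" by blast
      qed
    qed
    then have "card (vec.span (insert a B)) = CARD('f) * card (vec.span B)"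
      by (metis bij_betw_same_card card_cartesian_product)
    then show ?case using insert B by simp
  qed simp
  obtain B where B: "B \<subseteq> S" "vec.independent B" "S \<subseteq> vec.span B" "card B = vec.dim S"
    using vec.basis_exists by blast
  then have "vec.span B = S" using assms vec.span_minimal by blast
  then show ?thesis using span[of B] B by simp
qed

definition points :: "('f::{field,finite} ^ 'd) set \<Rightarrow> ('f ^ 'd) set set" where
  "points U = {Y \<in> subspaces_of_dim 1. Y \<subseteq> U}"

lemma subspace_one_iff:
  "X \<in> subspaces_of_dim 1 \<longleftrightarrow> (\<exists>x. x \<noteq> 0 \<and> X = vec.span {x})"
proof
  assume X: "X \<in> subspaces_of_dim 1"
  then have "vec.subspace X" "vec.dim X = 1" by (auto simp: subspaces_of_dim_def)
  moreover obtain B where B: "B \<subseteq> X" "vec.independent B" "X \<subseteq> vec.span B" "card B = vec.dim X"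
    using vec.basis_exists by blast
  ultimately obtain b where "B = {b}" by (metis card_1_singletonE)
  moreover have "vec.span B = X" using B \<open>vec.subspace X\<close> vec.span_minimal by blast
  ultimately show "\<exists>x. x \<noteq> 0 \<and> X = vec.span {x}" using B(2) by auto
next
  assume "\<exists>x. x \<noteq> 0 \<and> X = vec.span {x}"
  then show "X \<in> subspaces_of_dim 1"
    by (auto simp: subspaces_of_dim_def)
qed

lemma span_singleton_in_points:
  assumes "vec.subspace U" "x \<in> U" "x \<noteq> 0"
  shows "vec.span {x} \<in> points U"
proof -
  have "vec.span {x} \<subseteq> U" using assms(1,2) by (simp add: vec.span_minimal)
  then show ?thesis using assms(3) unfolding points_def subspace_one_iff by blast
qed

lemma vertex_eq_span:
  assumes X: "X \<in> subspaces_of_dim 1" and "x \<in> X" "x \<noteq> 0"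
  shows "X = vec.span {x}"
proof -
  have sub: "vec.subspace X" and dim: "vec.dim X = 1"
    using X by (auto simp: subspaces_of_dim_def)
  have "vec.span {x} \<subseteq> X" using sub \<open>x \<in> X\<close> by (simp add: vec.span_minimal)
  moreover have "vec.dim (vec.span {x}) = 1" using \<open>x \<noteq> 0\<close> by simp
  ultimately show ?thesis
    using vec.subspace_dim_equal[of "vec.span {x}" X] sub dim by simp
qed

text \<open>
  The nonzero vectors of \<open>U\<close> are partitioned by its points into sets of size \<open>q - 1\<close>. The
  multiplied form avoids a division: the number of points is the Gaussian number
  \<open>(q\<^sup>d - 1) / (q - 1)\<close>.
\<close>

lemma card_points:
  fixes U :: "('f::{field,finite} ^ 'd) set"
  assumes U: "vec.subspace U"
  shows "card (points U) * (CARD('f) - 1) + 1 = CARD('f) ^ vec.dim U"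
proof -
  have "U - {0} = (\<Union>Y\<in>points U. Y - {0})"
  proof (intro equalityI subsetI)
    fix x assume "x \<in> U - {0}"
    then show "x \<in> (\<Union>Y\<in>points U. Y - {0})"
      using span_singleton_in_points[OF U] vec.span_base[of x "{x}"] by blast
  qed (auto simp: points_def)
  moreover have "card (\<Union>Y\<in>points U. Y - {0}) = (\<Sum>Y\<in>points U. card (Y - {0}))"
  proof (rule card_UN_disjoint)
    show "\<forall>X\<in>points U. \<forall>Y\<in>points U. X \<noteq> Y \<longrightarrow> (X - {0}) \<inter> (Y - {0}) = {}"
    proof (intro ballI impI)
      fix X Y assume "X \<in> points U" "Y \<in> points U" "X \<noteq> Y"
      then show "(X - {0}) \<inter> (Y - {0}) = {}"
        using vertex_eq_span[of X] vertex_eq_span[of Y] unfolding points_def by fast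
    qed
  qed simp_all
  moreover have "(\<Sum>Y\<in>points U. card (Y - {0})) = (\<Sum>Y\<in>points U. CARD('f) - 1)"
  proof (rule sum.cong[OF refl])
    fix Y assume "Y \<in> points U"
    then have "vec.subspace Y" "vec.dim Y = 1" by (auto simp: points_def subspaces_of_dim_def)
    then show "card (Y - {0}) = CARD('f) - 1"
      using card_subspace[of Y] by (simp add: card_Diff_singleton vec.subspace_0)
  qed
  ultimately have "card (U - {0}) = card (points U) * (CARD('f) - 1)" by simp
  then show ?thesis
    using card_subspace[OF U] vec.subspace_0[OF U]
    by (metis Suc_eq_plus1 card_Suc_Diff1 finite)
qed

lemma points_mono: "A \<subseteq> B \<Longrightarrow> points A \<subseteq> points B"
  by (auto simp: points_def)

lemma Union_points:
  assumes "vec.subspace U" and "0 < vec.dim U"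
  shows "\<Union> (points U) = U"
proof (intro equalityI subsetI)
  fix x assume "x \<in> U"
  have ex: "\<exists>y. y \<in> U \<and> y \<noteq> 0"
  proof (rule ccontr)
    assume "\<not> (\<exists>y. y \<in> U \<and> y \<noteq> 0)"
    then have "U \<subseteq> {0}" by blast
    then show False using assms(2) vec.dim_eq_0 by (metis less_irrefl)
  qed
  show "x \<in> \<Union> (points U)"
  proof (cases "x = 0")
    case True
    then show ?thesis using ex span_singleton_in_points[OF assms(1)] vec.span_zero by blast
  next
    case False
    then show ?thesis
      using span_singleton_in_points[OF assms(1) \<open>x \<in> U\<close>] vec.span_base[of x "{x}"] by blast
  qed
qed (auto simp: points_def)

lemma subset_if_points_subset:
  assumes "vec.subspace A" "0 < vec.dim A" and "points A \<subseteq> points B"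
  shows "A \<subseteq> B"
proof -
  have "A = \<Union> (points A)" by (rule Union_points[symmetric, OF assms(1,2)])
  also have "\<dots> \<subseteq> B" using assms(3) unfolding points_def by blast
  finally show ?thesis .
qed

lemma dim_span_two_vertices:
  assumes X: "X \<in> subspaces_of_dim 1" and Y: "Y \<in> subspaces_of_dim 1" and "X \<noteq> Y"
  shows "vec.span (X \<union> Y) \<in> subspaces_of_dim 2"
proof -
  obtain x where x: "x \<noteq> 0" "X = vec.span {x}" using X subspace_one_iff by blast
  obtain y where y: "y \<noteq> 0" "Y = vec.span {y}" using Y subspace_one_iff by blast
  have "y \<notin> vec.span {x}" using vertex_eq_span[OF X, of y] x y \<open>X \<noteq> Y\<close> by blast
  have "vec.span (X \<union> Y) = vec.span {y, x}"
  proof -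
    have "X \<subseteq> vec.span {y, x}" "Y \<subseteq> vec.span {y, x}"
      unfolding x(2) y(2) by (rule vec.span_mono, simp)+
    moreover have "x \<in> X" "y \<in> Y" unfolding x(2) y(2) by (simp_all add: vec.span_base)
    then have "{y, x} \<subseteq> vec.span (X \<union> Y)"
      using vec.span_superset[of "X \<union> Y"] by blast
    ultimately show ?thesis
      by (intro equalityI vec.span_minimal) simp_all
  qed
  moreover have "vec.dim {y, x} = 2"
    using \<open>y \<notin> vec.span {x}\<close> x by (simp add: vec.dim_insert)
  ultimately show ?thesis by (simp add: subspaces_of_dim_def)
qed

lemma line_eq_span_two_vertices:
  assumes "L \<in> subspaces_of_dim 2"
  obtains X Y where "X \<in> points L" "Y \<in> points L" "X \<noteq> Y" "L = vec.span (X \<union> Y)"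
proof -
  have L: "vec.subspace L" "vec.dim L = 2" using assms by (auto simp: subspaces_of_dim_def)
  have "\<not> L \<subseteq> vec.span {}"
    using vec.dim_mono[of L "{}"] L(2) by auto
  then obtain x where x: "x \<in> L" "x \<noteq> 0" by auto
  have "\<not> L \<subseteq> vec.span {x}"
    using vec.dim_mono[of L "{x}"] L(2) x by auto
  then obtain y where y: "y \<in> L" "y \<notin> vec.span {x}" by auto
  then have "y \<noteq> 0" using vec.span_zero by blast
  define X Y where "X = vec.span {x}" and "Y = vec.span {y}"
  have pts: "X \<in> points L" "Y \<in> points L"
    using span_singleton_in_points[OF L(1)] x y \<open>y \<noteq> 0\<close> by (simp_all add: X_def Y_def)
  moreover have "X \<noteq> Y" using y vec.span_base[of y "{y}"] by (auto simp: X_def Y_def)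
  moreover have "vec.span (X \<union> Y) = L"
  proof (rule vec.subspace_dim_equal)
    show "vec.span (X \<union> Y) \<subseteq> L"
      using pts L by (intro vec.span_minimal) (auto simp: points_def)
    show "vec.dim L \<le> vec.dim (vec.span (X \<union> Y))"
      using dim_span_two_vertices[OF _ _ \<open>X \<noteq> Y\<close>] pts L
      by (simp add: points_def subspaces_of_dim_def)
  qed (use L in auto)
  ultimately show ?thesis using that by metis
qed

text \<open>
  The nonzero vectors are partitioned by the spread into sets of size \<open>q ^ n - 1\<close>.
\<close>

lemma spread_order_dvd:
  fixes \<G> :: "('f::{field,finite} ^ 'd) set set"
  assumes "spread n \<G>"
  shows "CARD('f) ^ n - 1 dvd CARD('f) ^ CARD('d) - 1"
proof -
  have sub: "vec.subspace G" "vec.dim G = n" if "G \<in> \<G>" for G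
    using assms that by (auto simp: spread_def subspaces_of_dim_def)
  have uniq: "\<And>x. x \<noteq> 0 \<Longrightarrow> \<exists>!S. S \<in> \<G> \<and> x \<in> S" using assms by (simp add: spread_def)
  let ?C = "(\<lambda>G. G - {0}) ` \<G>"
  have "CARD('f) ^ n - 1 dvd card (\<Union> ?C)"
  proof (rule dvd_partition)
    show "\<forall>c\<in>?C. CARD('f) ^ n - 1 dvd card c"
    proof (rule ballI)
      fix c assume "c \<in> ?C"
      then obtain G where G: "G \<in> \<G>" "c = G - {0}" by blast
      then have "card c = CARD('f) ^ n - 1"
        using card_subspace[OF sub(1)[OF G(1)]] sub(2)[OF G(1)] vec.subspace_0[OF sub(1)[OF G(1)]]
        by (simp add: card_Diff_singleton)
      then show "CARD('f) ^ n - 1 dvd card c" by simp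
    qed
    show "\<forall>c1\<in>?C. \<forall>c2\<in>?C. c1 \<noteq> c2 \<longrightarrow> c1 \<inter> c2 = {}"
      using uniq by blast
  qed simp
  moreover have "\<Union> ?C = UNIV - {0}" using uniq by blast
  moreover have "card (UNIV - {0} :: ('f ^ 'd) set) = CARD('f) ^ CARD('d) - 1"
    using card_subspace[OF vec.subspace_UNIV, where 'f='f and 'd='d]
    by (simp add: card_Diff_singleton vec_dim_card)
  ultimately show ?thesis by simp
qed

section \<open>Divisible designs and uniform adjacency\<close>

locale divisible_design =
  fixes E \<G> :: "('f::{field,finite} ^ 'd) set set" and k l1 l2 n :: nat
  assumes ddg: "q_DDG k l1 l2 n \<G> E" and n_ge_2: "2 \<le> n" and n_less: "n < CARD('d)"
begin

abbreviation V :: "('f ^ 'd) set set" where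
  "V \<equiv> subspaces_of_dim 1"

abbreviation adj :: "('f ^ 'd) set \<Rightarrow> ('f ^ 'd) set \<Rightarrow> bool" where
  "adj \<equiv> adjacent E"

definition N :: "('f ^ 'd) set \<Rightarrow> ('f ^ 'd) set set" where
  "N X = {Y. adj X Y}"

text \<open>
  By regularity this union is a subspace, and its points are exactly the members of the
  neighborhood of \<open>X\<close>.
\<close>

definition nbspace :: "('f ^ 'd) set \<Rightarrow> ('f ^ 'd) set" where
  "nbspace X = \<Union> (neighborhood E X)"

text \<open>
  The description is unique when \<open>X\<close> is a vertex: this is the spread element through \<open>X\<close>.
\<close>

definition cls :: "('f ^ 'd) set \<Rightarrow> ('f ^ 'd) set" where
  "cls X = (THE G. G \<in> \<G> \<and> X \<subseteq> G)"

lemma spread: "spread n \<G>" and regular: "regular_graph k E"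
  using ddg by (auto simp: q_DDG_def)

lemma edges: "E \<subseteq> subspaces_of_dim 2"
  using regular by (simp add: regular_graph_def q_ary_graph_def)

lemma adj_sym: "adj X Y \<longleftrightarrow> adj Y X"
  by (auto simp: adjacent_def Un_commute)

lemma adjD: "adj X Y \<Longrightarrow> X \<in> V \<and> Y \<in> V \<and> X \<noteq> Y"
  by (simp add: adjacent_def)

lemma points_UNIV: "points UNIV = V"
  by (simp add: points_def)

lemma nbspace:
  assumes "X \<in> V"
  shows "vec.subspace (nbspace X)" "vec.dim (nbspace X) = k + 1"
    and neighborhood_eq: "neighborhood E X = points (nbspace X)"
proof -
  obtain U where U: "U \<in> subspaces_of_dim (k + 1)" "neighborhood E X = points U"
    using regular assms by (auto simp: regular_graph_def points_def)
  have "nbspace X = U"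
    using U Union_points[of U] by (simp add: nbspace_def subspaces_of_dim_def)
  then show "vec.subspace (nbspace X)" "vec.dim (nbspace X) = k + 1"
    "neighborhood E X = points (nbspace X)"
    using U by (simp_all add: subspaces_of_dim_def)
qed

lemma N_eq: "X \<in> V \<Longrightarrow> N X = points (nbspace X) - {X}"
  using neighborhood_eq[of X] adjD[of X] by (auto simp: N_def neighborhood_def)

lemma self_in_nbspace: "X \<in> V \<Longrightarrow> X \<in> points (nbspace X)"
  using neighborhood_eq[of X] by (auto simp: neighborhood_def)

lemma adj_iff: "X \<in> V \<Longrightarrow> Y \<in> V \<Longrightarrow> X \<noteq> Y \<Longrightarrow> adj X Y \<longleftrightarrow> Y \<subseteq> nbspace X"
  using N_eq[of X] by (auto simp: N_def points_def)

lemma N_subset: "X \<in> V \<Longrightarrow> N X \<subseteq> V"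
  by (auto simp: N_def adjacent_def)

lemma N_sym: "Y \<in> N X \<Longrightarrow> X \<in> N Y"
  by (simp add: N_def adj_sym)

lemma N_irrefl: "X \<notin> N X"
  by (simp add: N_def adjacent_def)

lemma card_N: "X \<in> V \<Longrightarrow> card (N X) = card (points (nbspace X)) - 1"
  by (simp add: N_eq card_Diff_singleton self_in_nbspace)

lemma ex1_class:
  assumes X: "X \<in> V"
  shows "\<exists>!G. G \<in> \<G> \<and> X \<subseteq> G"
proof -
  obtain x where x: "x \<noteq> 0" "X = vec.span {x}" using X subspace_one_iff by blast
  have "X \<subseteq> G \<longleftrightarrow> x \<in> G" if "G \<in> \<G>" for G
  proof -
    have "vec.subspace G" using spread that by (auto simp: spread_def subspaces_of_dim_def)
    then show ?thesis
      using x vec.span_minimal[of "{x}" G] vec.span_base[of x "{x}"] by auto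
  qed
  moreover have "\<exists>!G. G \<in> \<G> \<and> x \<in> G" using spread x(1) by (simp add: spread_def)
  ultimately show ?thesis by metis
qed

lemma cls: "X \<in> V \<Longrightarrow> cls X \<in> \<G>" "X \<in> V \<Longrightarrow> X \<subseteq> cls X"
  using theI'[OF ex1_class] by (auto simp: cls_def)

lemma cls_eqI: "X \<in> V \<Longrightarrow> G \<in> \<G> \<Longrightarrow> X \<subseteq> G \<Longrightarrow> cls X = G"
  using ex1_class[of X] cls[of X] by blast

lemma cls_eq_iff: "X \<in> V \<Longrightarrow> Y \<in> V \<Longrightarrow> Y \<subseteq> cls X \<longleftrightarrow> cls Y = cls X"
  using cls cls_eqI by metis

lemma subspace_cls: "X \<in> V \<Longrightarrow> vec.subspace (cls X)"
  and dim_cls: "X \<in> V \<Longrightarrow> vec.dim (cls X) = n"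
  using spread cls by (auto simp: spread_def subspaces_of_dim_def)

lemma card_common:
  assumes "X \<in> V" "Y \<in> V" "X \<noteq> Y"
  shows "card (N X \<inter> N Y) = (if Y \<subseteq> cls X then l1 else l2)"
proof -
  have "(neighborhood E X \<inter> neighborhood E Y) - {X, Y} = N X \<inter> N Y"
    using N_irrefl by (auto simp: neighborhood_def N_def)
  moreover have "(\<exists>G\<in>\<G>. X \<subseteq> G \<and> Y \<subseteq> G) \<longleftrightarrow> Y \<subseteq> cls X"
    using assms cls cls_eqI by metis
  moreover have "card ((neighborhood E X \<inter> neighborhood E Y) - {X, Y})
      = (if \<exists>G\<in>\<G>. X \<subseteq> G \<and> Y \<subseteq> G then l1 else l2)"
    using ddg assms unfolding q_DDG_def by blast
  ultimately show ?thesis by simp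
qed

text \<open>
  The vertices \<open>X\<close> and \<open>Y\<close> are not their own neighbors, but they lie in both neighborhood
  spaces as soon as they are adjacent.
\<close>

lemma card_points_nbspace_Int:
  assumes "X \<in> V" "Y \<in> V" "X \<noteq> Y"
  shows "card (points (nbspace X \<inter> nbspace Y)) = card (N X \<inter> N Y) + (if adj X Y then 2 else 0)"
proof (cases "adj X Y")
  case True
  have "points (nbspace X \<inter> nbspace Y) = points (nbspace X) \<inter> points (nbspace Y)"
    by (auto simp: points_def)
  also have "\<dots> = insert X (insert Y (N X \<inter> N Y))"
  proof -
    have "Y \<in> N X" "X \<in> N Y" using True by (simp_all add: N_def adj_sym)
    then show ?thesis
      using N_eq[OF assms(1)] N_eq[OF assms(2)] self_in_nbspace assms by blast
  qed
  finally show ?thesis using True assms N_irrefl by simp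
next
  case False
  have "points (nbspace X \<inter> nbspace Y) = points (nbspace X) \<inter> points (nbspace Y)"
    by (auto simp: points_def)
  also have "\<dots> = N X \<inter> N Y"
  proof -
    have "Y \<notin> N X" "X \<notin> N Y" using False by (simp_all add: N_def adj_sym)
    then show ?thesis
      using N_eq[OF assms(1)] N_eq[OF assms(2)] assms by blast
  qed
  finally show ?thesis using False by simp
qed

lemma subspace_nbspace_Int:
  "X \<in> V \<Longrightarrow> Y \<in> V \<Longrightarrow> vec.subspace (nbspace X \<inter> nbspace Y)"
  by (simp add: nbspace vec.subspace_inter)

text \<open>
  An adjacent and a non-adjacent pair with equally many common neighbors give intersections of
  neighborhood spaces whose numbers of points differ by 2.
\<close>

lemma homogeneous_or_binary:
  assumes XY: "X \<in> V" "Y \<in> V" "X \<noteq> Y" "adj X Y"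
    and XY': "X' \<in> V" "Y' \<in> V" "X' \<noteq> Y'" "\<not> adj X' Y'"
    and same: "card (N X \<inter> N Y) = card (N X' \<inter> N Y')"
  shows "CARD('f) = 2 \<and> card (N X \<inter> N Y) = 1"
proof -
  have "2 \<le> CARD('f)"
    using card_mono[of "UNIV :: 'f set" "{0, 1}"] by simp
  moreover have "card (points (nbspace X \<inter> nbspace Y))
      = card (points (nbspace X' \<inter> nbspace Y')) + 2"
    using card_points_nbspace_Int XY XY' same by simp
  moreover note card_points[OF subspace_nbspace_Int[OF XY(1,2)]]
    and card_points[OF subspace_nbspace_Int[OF XY'(1,2)]]
  ultimately have "CARD('f) = 2 \<and> card (points (nbspace X' \<inter> nbspace Y')) = 1"
    using gauss_number_difference_two by blast
  then show ?thesis using card_points_nbspace_Int[OF XY'(1-3)] XY'(4) same by simp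
qed

text \<open>
  Adjacency is uniform on the pairs of distinct vertices inside spread elements, respectively on
  the pairs in different spread elements; the argument says whether these pairs are adjacent.
\<close>

definition adj_within :: "bool \<Rightarrow> bool" where
  "adj_within b \<longleftrightarrow> (\<forall>X\<in>V. \<forall>Y\<in>V. X \<noteq> Y \<longrightarrow> Y \<subseteq> cls X \<longrightarrow> adj X Y = b)"

definition adj_across :: "bool \<Rightarrow> bool" where
  "adj_across b \<longleftrightarrow> (\<forall>X\<in>V. \<forall>Y\<in>V. \<not> Y \<subseteq> cls X \<longrightarrow> adj X Y = b)"

lemma across_ne: "X \<in> V \<Longrightarrow> \<not> Y \<subseteq> cls X \<Longrightarrow> X \<noteq> Y"
  using cls by auto

lemma within_cases: "adj_within True \<or> adj_within False \<or> CARD('f) = 2 \<and> l1 = 1"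
proof (rule ccontr)
  assume *: "\<not> ?thesis"
  then obtain X Y X' Y' where "X \<in> V" "Y \<in> V" "X \<noteq> Y" "Y \<subseteq> cls X" "adj X Y"
    "X' \<in> V" "Y' \<in> V" "X' \<noteq> Y'" "Y' \<subseteq> cls X'" "\<not> adj X' Y'"
    unfolding adj_within_def by blast
  then show False
    using * homogeneous_or_binary[of X Y X' Y'] card_common by simp
qed

lemma across_cases: "adj_across True \<or> adj_across False \<or> CARD('f) = 2 \<and> l2 = 1"
proof (rule ccontr)
  assume *: "\<not> ?thesis"
  then obtain X Y X' Y' where "X \<in> V" "Y \<in> V" "\<not> Y \<subseteq> cls X" "adj X Y"
    "X' \<in> V" "Y' \<in> V" "\<not> Y' \<subseteq> cls X'" "\<not> adj X' Y'"
    unfolding adj_across_def by blast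
  then show False
    using * homogeneous_or_binary[of X Y X' Y'] card_common across_ne by simp
qed

lemma empty_graphI:
  assumes "adj_within False" "adj_across False"
  shows "E = empty_graph"
proof -
  have "L \<notin> E" for L
  proof
    assume "L \<in> E"
    then obtain X Y where "X \<in> points L" "Y \<in> points L" "X \<noteq> Y" "L = vec.span (X \<union> Y)"
      using edges line_eq_span_two_vertices by (metis subsetD)
    then have "X \<in> V" "Y \<in> V" "adj X Y" "X \<noteq> Y"
      using \<open>L \<in> E\<close> by (auto simp: adjacent_def points_def)
    then show False using assms unfolding adj_within_def adj_across_def by blast
  qed
  then show ?thesis by (auto simp: empty_graph_def)
qed

lemma union_graphI:
  assumes "adj_within True" "adj_across False"
  shows "E = union_of_complete_graphs \<G>"
proof (intro equalityI subsetI)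
  fix L assume "L \<in> E"
  then have L2: "L \<in> subspaces_of_dim 2" using edges by blast
  then obtain X Y where XY: "X \<in> points L" "Y \<in> points L" "X \<noteq> Y" "L = vec.span (X \<union> Y)"
    using line_eq_span_two_vertices by blast
  then have V: "X \<in> V" "Y \<in> V" and "adj X Y"
    using \<open>L \<in> E\<close> by (auto simp: adjacent_def points_def)
  then have "Y \<subseteq> cls X" using assms(2) by (auto simp: adj_across_def)
  then have "L \<subseteq> cls X"
    unfolding XY(4) using V cls subspace_cls by (intro vec.span_minimal) auto
  then show "L \<in> union_of_complete_graphs \<G>"
    using L2 cls V by (auto simp: union_of_complete_graphs_def)
next
  fix L assume "L \<in> union_of_complete_graphs \<G>"
  then obtain G where G: "L \<in> subspaces_of_dim 2" "G \<in> \<G>" "L \<subseteq> G"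
    by (auto simp: union_of_complete_graphs_def)
  obtain X Y where XY: "X \<in> points L" "Y \<in> points L" "X \<noteq> Y" "L = vec.span (X \<union> Y)"
    using line_eq_span_two_vertices[OF G(1)] by blast
  then have "X \<in> V" "Y \<in> V" "X \<subseteq> G" "Y \<subseteq> G" using G by (auto simp: points_def)
  then have "Y \<subseteq> cls X" using cls_eqI G by simp
  then have "adj X Y" using assms(1) \<open>X \<in> V\<close> \<open>Y \<in> V\<close> XY(3) by (simp add: adj_within_def)
  then show "L \<in> E" using XY(4) by (simp add: adjacent_def)
qed

text \<open>
  Every vector outside the spread element through \<open>X\<close> lies in the neighborhood space of \<open>X\<close>. The
  complement of a proper subspace spans the whole space, so the neighborhood space is everything
  and pairs inside spread elements are adjacent as well.
\<close>

lemma complete_graphI: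
  assumes "adj_across True"
  shows "E = complete_graph"
proof -
  have full: "nbspace X = UNIV" if X: "X \<in> V" for X
  proof -
    have outside: "y \<in> nbspace X" if "y \<notin> cls X" for y
    proof -
      have "y \<noteq> 0" using that vec.subspace_0[OF subspace_cls[OF X]] by auto
      have Y: "vec.span {y} \<in> V" using \<open>y \<noteq> 0\<close> subspace_one_iff by blast
      have y: "y \<in> vec.span {y}" by (simp add: vec.span_base)
      then have nin: "\<not> vec.span {y} \<subseteq> cls X" using that by blast
      then have "adj X (vec.span {y})" using assms X Y by (simp add: adj_across_def)
      then have "vec.span {y} \<subseteq> nbspace X" using adj_iff[OF X Y] across_ne[OF X nin] by simp
      then show ?thesis using y by blast
    qed
    have "cls X \<noteq> UNIV"
      using dim_cls[OF X] n_less vec_dim_card[where 'a='f and 'n='d] by auto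
    then obtain w where w: "w \<notin> cls X" by blast
    have "y \<in> nbspace X" for y
    proof (cases "y \<in> cls X")
      case True
      have "y + w \<notin> cls X"
      proof
        assume "y + w \<in> cls X"
        then have "(y + w) - y \<in> cls X"
          using True subspace_cls[OF X] vec.subspace_diff by blast
        then show False using w by simp
      qed
      then have "(y + w) - w \<in> nbspace X"
        using w outside nbspace(1)[OF X] vec.subspace_diff by blast
      then show ?thesis by simp
    qed (rule outside)
    then show ?thesis by blast
  qed
  have "L \<in> E" if L: "L \<in> subspaces_of_dim 2" for L
  proof -
    obtain X Y where XY: "X \<in> points L" "Y \<in> points L" "X \<noteq> Y" "L = vec.span (X \<union> Y)"
      using line_eq_span_two_vertices[OF L] by blast
    then have "adj X Y" using adj_iff full by (simp add: points_def)
    then show ?thesis using XY(4) by (simp add: adjacent_def)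
  qed
  then show ?thesis using edges by (auto simp: complete_graph_def)
qed

section \<open>The exceptional parameters over the field with two elements\<close>

lemma V_nonempty: "\<exists>X. X \<in> V"
proof -
  have "(axis undefined 1 :: 'f ^ 'd) \<noteq> 0" by (simp add: axis_eq_0_iff)
  then show ?thesis using subspace_one_iff by blast
qed

lemma ex_across:
  assumes X: "X \<in> V"
  shows "\<exists>Y\<in>V. \<not> Y \<subseteq> cls X"
proof -
  have "cls X \<noteq> UNIV"
    using dim_cls[OF X] n_less vec_dim_card[where 'a='f and 'n='d] by auto
  then obtain w where w: "w \<notin> cls X" by blast
  then have "w \<noteq> 0" using vec.subspace_0[OF subspace_cls[OF X]] by auto
  then show ?thesis using w vec.span_base[of w "{w}"] subspace_one_iff by blast
qed

lemma binary_card_points: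
  assumes "CARD('f) = 2" "vec.subspace U"
  shows "card (points (U :: ('f ^ 'd) set)) = 2 ^ vec.dim U - 1"
  using card_points[OF assms(2)] assms(1) by simp

lemma ex_within:
  assumes X: "X \<in> V"
  shows "\<exists>Y\<in>V. Y \<noteq> X \<and> Y \<subseteq> cls X"
proof (rule ccontr)
  assume "\<not> ?thesis"
  then have "points (cls X) \<subseteq> {X}" by (auto simp: points_def)
  then have "cls X \<subseteq> X"
    using Union_points[OF subspace_cls[OF X]] dim_cls[OF X] n_ge_2 by auto
  then have "vec.dim (cls X) \<le> vec.dim X" by (rule vec.dim_subset)
  then show False using dim_cls[OF X] n_ge_2 X by (simp add: subspaces_of_dim_def)
qed

text \<open>
  The paths of length two starting at a fixed vertex are counted by their end point, of which
  \<open>2 ^ n - 2\<close> lie in the same spread element and \<open>2 ^ v - 2 ^ n\<close> in other ones.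
\<close>

lemma binary_counting:
  assumes q: "CARD('f) = 2"
  shows "(2 ^ (k + 1) - 2) * (2 ^ (k + 1) - 3) = (2 ^ n - 2) * l1 + (2 ^ CARD('d) - 2 ^ n) * l2"
proof -
  obtain X where X: "X \<in> V" using V_nonempty by blast
  have deg: "card (N Y) = 2 ^ (k + 1) - 2" if "Y \<in> V" for Y
    using card_N[OF that] binary_card_points[OF q nbspace(1)[OF that]] nbspace(2)[OF that] by simp
  have "(2 ^ (k + 1) - 2) * (2 ^ (k + 1) - 2 - 1) = (\<Sum>Y\<in>V - {X}. card (N X \<inter> N Y))"
    by (rule sum_card_common_neighbors[symmetric]) (use N_subset N_sym deg X in auto)
  also have "\<dots> = (\<Sum>Y\<in>V - {X}. if Y \<subseteq> cls X then l1 else l2)"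
  proof (rule sum.cong[OF refl])
    fix Y assume "Y \<in> V - {X}"
    then show "card (N X \<inter> N Y) = (if Y \<subseteq> cls X then l1 else l2)"
      using X by (intro card_common) blast+
  qed
  also have "\<dots> = (\<Sum>Y\<in>(V - {X}) \<inter> {Y. Y \<subseteq> cls X}. l1) + (\<Sum>Y\<in>(V - {X}) \<inter> - {Y. Y \<subseteq> cls X}. l2)"
    by (rule sum.If_cases) simp
  also have "(V - {X}) \<inter> {Y. Y \<subseteq> cls X} = points (cls X) - {X}"
    by (auto simp: points_def)
  also have "(V - {X}) \<inter> - {Y. Y \<subseteq> cls X} = points UNIV - points (cls X)"
    using cls(2)[OF X] by (auto simp: points_def)
  also have "(\<Sum>Y\<in>points (cls X) - {X}. l1) = (2 ^ n - 2) * l1"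
  proof -
    have "X \<in> points (cls X)" using X cls by (simp add: points_def)
    then show ?thesis
      using binary_card_points[OF q subspace_cls[OF X]] dim_cls[OF X]
      by (simp add: card_Diff_singleton numeral_2_eq_2)
  qed
  also have "(\<Sum>Y\<in>points UNIV - points (cls X). l2) = (2 ^ CARD('d) - 2 ^ n) * l2"
    using binary_card_points[OF q subspace_cls[OF X]] dim_cls[OF X]
      binary_card_points[OF q vec.subspace_UNIV]
    by (simp add: card_Diff_subset points_mono vec_dim_card del: vec.dim_UNIV)
  finally show ?thesis by simp
qed

text \<open>
  The points of \<open>U\<close> would form a graph on 31 vertices, regular of degree 6, in which any two
  vertices have a unique common neighbor.
\<close>

lemma binary_friendship:
  assumes q: "CARD('f) = 2" and U: "vec.subspace U" "vec.dim U = 5" and k: "k = 2"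
    and closed: "\<And>X. X \<in> points U \<Longrightarrow> N X \<subseteq> points U"
    and common: "\<And>X Y. X \<in> points U \<Longrightarrow> Y \<in> points U \<Longrightarrow> X \<noteq> Y \<Longrightarrow> card (N X \<inter> N Y) = 1"
  shows False
proof -
  have "5 dvd card (points U)"
  proof (rule friendship_graph_dvd[where N = N and j = 1])
    fix X assume "X \<in> points U"
    then have X: "X \<in> V" by (simp add: points_def)
    show "card (N X) = 5 * 1 + 1"
      using card_N[OF X] binary_card_points[OF q nbspace(1)[OF X]] nbspace(2)[OF X] k by simp
  qed (use closed common N_sym N_irrefl in auto)
  then show False using binary_card_points[OF q U(1)] U(2) by simp
qed

lemma not_both_one:
  assumes q: "CARD('f) = 2" and "l1 = 1" "l2 = 1"
  shows False
proof -
  have "(2::nat) ^ 2 \<le> 2 ^ n" "(2::nat) ^ n \<le> 2 ^ CARD('d)"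
    by (rule power_increasing; use n_ge_2 n_less in simp)+
  then have "(2 ^ (k + 1) - 2) * (2 ^ (k + 1) - 3) = (2 ^ CARD('d) - 2 :: nat)"
    using binary_counting[OF q] assms by simp
  then have kd: "k + 1 = 2 \<and> CARD('d) = 2 \<or> k + 1 = 3 \<and> CARD('d) = 5"
    by (rule friendship_equation) (use n_ge_2 n_less in simp)
  then have "k = 2" "CARD('d) = 5" using n_ge_2 n_less by auto
  have "card (N X \<inter> N Y) = 1" if "X \<in> V" "Y \<in> V" "X \<noteq> Y" for X Y
    using card_common[OF that] assms by simp
  moreover have "vec.dim (UNIV :: ('f ^ 'd) set) = 5"
    using vec_dim_card[where 'a='f and 'n='d] \<open>CARD('d) = 5\<close> by simp
  ultimately show False
    using binary_friendship[OF q vec.subspace_UNIV _ \<open>k = 2\<close>] N_subset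
    unfolding points_UNIV by blast
qed

text \<open>
  Since adjacent vertices share their spread element, \<open>l2 = 0\<close>, and each spread element carries a
  graph with unique common neighbors. The counting equation leaves the sporadic parameters of
  degree 6 on 31 vertices and the case \<open>k + 1 = n = 2\<close>, in which neighborhood spaces are spread
  elements.
\<close>

lemma across_False_l1_one:
  assumes q: "CARD('f) = 2" and l1: "l1 = 1" and unif: "adj_across False"
  shows "adj_within True"
proof -
  have nb: "N X \<subseteq> points (cls X)" if "X \<in> V" for X
  proof
    fix Y assume "Y \<in> N X"
    then have "adj X Y" "Y \<in> V" using adjD by (auto simp: N_def)
    then have "Y \<subseteq> cls X" using unif that unfolding adj_across_def by blast
    then show "Y \<in> points (cls X)" using \<open>Y \<in> V\<close> by (simp add: points_def)
  qed
  have l2: "l2 = 0"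
  proof -
    obtain X where X: "X \<in> V" using V_nonempty by blast
    obtain Y where Y: "Y \<in> V" "\<not> Y \<subseteq> cls X" using ex_across[OF X] by blast
    have "N X \<inter> N Y = {}"
    proof (rule ccontr)
      assume "N X \<inter> N Y \<noteq> {}"
      then obtain Z where "Z \<in> points (cls X)" "Z \<in> points (cls Y)" using nb X Y by blast
      then have "Z \<in> V" "Z \<subseteq> cls X" "Z \<subseteq> cls Y" by (simp_all add: points_def)
      then have "cls X = cls Y" using X Y cls_eq_iff by metis
      then show False using Y cls by metis
    qed
    then show ?thesis using card_common[OF X Y(1) across_ne[OF X Y(2)]] Y(2) by simp
  qed
  have "(2 ^ (k + 1) - 2) * (2 ^ (k + 1) - 3) = (2 ^ n - 2 :: nat)"
    using binary_counting[OF q] unfolding l1 l2 by (simp only: mult_1_right mult_0_right add_0_right)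
  then have kn: "k + 1 = 2 \<and> n = 2 \<or> k + 1 = 3 \<and> n = 5"
    by (rule friendship_equation) (fact n_ge_2)
  have "k + 1 = n"
  proof (rule ccontr)
    assume "k + 1 \<noteq> n"
    then have kn: "k = 2" "n = 5" using kn by auto
    obtain X where X: "X \<in> V" using V_nonempty by blast
    show False
    proof (rule binary_friendship[OF q subspace_cls[OF X]])
      show "vec.dim (cls X) = 5" using dim_cls[OF X] kn by simp
      show "k = 2" by (fact kn)
      fix Y assume "Y \<in> points (cls X)"
      then have Y: "Y \<in> V" "cls Y = cls X" using cls_eq_iff X by (auto simp: points_def)
      then show "N Y \<subseteq> points (cls X)" using nb by metis
      fix Z assume "Z \<in> points (cls X)" "Y \<noteq> Z"
      then show "card (N Y \<inter> N Z) = 1"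
        using card_common[of Y Z] Y l1 by (simp add: points_def)
    qed
  qed
  have "nbspace X = cls X" if X: "X \<in> V" for X
  proof (rule vec.subspace_dim_equal)
    have "X \<in> points (cls X)" using X cls by (simp add: points_def)
    then have "points (nbspace X) \<subseteq> points (cls X)"
      using nb[OF X] N_eq[OF X] by blast
    then show "nbspace X \<subseteq> cls X"
      using nbspace[OF X] subspace_cls[OF X] by (intro subset_if_points_subset) simp_all
    show "vec.dim (cls X) \<le> vec.dim (nbspace X)"
      using \<open>k + 1 = n\<close> dim_cls[OF X] nbspace(2)[OF X] by linarith
    show "vec.subspace (nbspace X)" by (rule nbspace(1)[OF X])
    show "vec.subspace (cls X)" by (rule subspace_cls[OF X])
  qed
  then show ?thesis using adj_iff by (simp add: adj_within_def)
qed

text \<open>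
  A vertex \<open>W\<close> outside the spread element of \<open>X\<close> cannot be adjacent to both \<open>X\<close> and another vertex
  \<open>Y\<close> of that element: for adjacent \<open>X\<close> and \<open>W\<close> the intersection of the neighborhood spaces is a line
  because \<open>l2 = 1\<close>, so it would be the line through \<open>X\<close> and \<open>Y\<close>, which misses \<open>W\<close>. Hence the common
  neighbors of \<open>X\<close> and \<open>Y\<close> are the other points of their spread element, which determines \<open>l1\<close>, and
  the counting equation leaves only \<open>n = 2\<close> and \<open>v = 5\<close>, where a spread would need 3 to divide 31.
\<close>

lemma within_True_l2_one:
  assumes q: "CARD('f) = 2" and l2: "l2 = 1" and unif: "adj_within True"
  shows False
proof -
  obtain X where X: "X \<in> V" using V_nonempty by blast
  obtain Y where Y: "Y \<in> V" "Y \<noteq> X" "Y \<subseteq> cls X" using ex_within[OF X] by blast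
  have adj_XY: "adj X Y" using unif X Y by (auto simp: adj_within_def)
  have sub: "points (cls X) - {X} \<subseteq> N X"
    using unif X by (auto simp: adj_within_def N_def points_def)
  have inside: "W \<subseteq> cls X" if "W \<in> N X \<inter> N Y" for W
  proof (rule ccontr)
    assume nin: "\<not> W \<subseteq> cls X"
    have W: "W \<in> V" "adj X W" "adj W Y" using that adjD by (auto simp: N_def adj_sym)
    let ?D = "nbspace X \<inter> nbspace W"
    have D: "vec.subspace ?D" using subspace_nbspace_Int X W by simp
    \<comment> \<open>one common neighbor, together with \<open>X\<close> and \<open>W\<close>\<close>
    have "card (points ?D) = 3"
      using card_points_nbspace_Int[OF X W(1) across_ne[OF X nin]]
        card_common[OF X W(1) across_ne[OF X nin]] nin W l2 by simp
    then have "(2::nat) ^ vec.dim ?D = 2 ^ 2" using card_points[OF D] q by simp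
    then have dim: "vec.dim ?D = 2" by (rule power_inject_exp[THEN iffD1, rotated]) simp
    have in_D: "X \<subseteq> ?D" "Y \<subseteq> ?D" "W \<subseteq> ?D"
    proof -
      have "X \<subseteq> nbspace X" "W \<subseteq> nbspace W"
        using self_in_nbspace X W(1) by (simp_all add: points_def)
      moreover have "Y \<subseteq> nbspace X" "W \<subseteq> nbspace X" "X \<subseteq> nbspace W" "Y \<subseteq> nbspace W"
        using adj_XY W adj_sym[of X W] adj_iff adjD by metis+
      ultimately show "X \<subseteq> ?D" "Y \<subseteq> ?D" "W \<subseteq> ?D" by blast+
    qed
    have "vec.span (X \<union> Y) = ?D"
    proof (rule vec.subspace_dim_equal)
      show "vec.span (X \<union> Y) \<subseteq> ?D" using in_D D by (intro vec.span_minimal) auto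
      show "vec.dim ?D \<le> vec.dim (vec.span (X \<union> Y))"
        using dim dim_span_two_vertices[OF X Y(1)] Y(2) by (auto simp: subspaces_of_dim_def)
    qed (use D in auto)
    moreover have "vec.span (X \<union> Y) \<subseteq> cls X"
      using cls X Y subspace_cls by (intro vec.span_minimal) auto
    ultimately show False using in_D nin by blast
  qed
  have "N X \<inter> N Y = points (cls X) - {X, Y}"
  proof (intro equalityI subsetI)
    fix W assume "W \<in> N X \<inter> N Y"
    then show "W \<in> points (cls X) - {X, Y}"
      using inside N_irrefl N_subset[OF X] by (auto simp: points_def)
  next
    fix W assume W: "W \<in> points (cls X) - {X, Y}"
    then have "W \<in> N X" using sub by blast
    moreover have "W \<in> N Y"
    proof -
      have "cls Y = cls X" using Y X cls_eq_iff by blast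
      moreover have "W \<in> V" "W \<subseteq> cls X" "Y \<noteq> W" using W by (auto simp: points_def)
      ultimately have "adj Y W" using unif Y(1) unfolding adj_within_def by metis
      then show ?thesis by (simp add: N_def adj_sym)
    qed
    ultimately show "W \<in> N X \<inter> N Y" by blast
  qed
  moreover have "X \<in> points (cls X)" "Y \<in> points (cls X)" using X Y cls by (auto simp: points_def)
  ultimately have "card (N X \<inter> N Y) = card (points (cls X)) - 2"
    using Y(2) by (simp add: card_Diff_subset)
  then have l1: "l1 = 2 ^ n - 3"
    using card_common[OF X Y(1)] Y binary_card_points[OF q subspace_cls[OF X]] dim_cls[OF X] by simp
  have "cls X \<subseteq> nbspace X"
  proof -
    have "points (cls X) \<subseteq> points (nbspace X)"
      using sub N_eq[OF X] self_in_nbspace[OF X] by blast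
    then show ?thesis
      using nbspace[OF X] subspace_cls[OF X] dim_cls[OF X] n_ge_2
      by (intro subset_if_points_subset) simp_all
  qed
  then have "n \<le> k + 1" using vec.dim_subset dim_cls[OF X] nbspace(2)[OF X] by metis
  then have "n = 2 \<and> CARD('d) = 5"
    using binary_counting[OF q] l1 l2 n_ge_2 n_less
    by (intro within_complete_equation) simp_all
  then show False using spread_order_dvd[OF spread] q by simp
qed

text \<open>
  For a non-adjacent pair inside a spread element, \<open>l1\<close> is the number of points of a subspace and so
  of the form \<open>2 ^ d - 1\<close>; the counting equation then leaves only \<open>d = 1\<close>.
\<close>

lemma within_False_l2_one:
  assumes q: "CARD('f) = 2" and l2: "l2 = 1" and unif: "adj_within False"
  shows "l1 = 1"
proof -
  obtain X where X: "X \<in> V" using V_nonempty by blast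
  obtain Y where Y: "Y \<in> V" "Y \<noteq> X" "Y \<subseteq> cls X" using ex_within[OF X] by blast
  have "\<not> adj X Y" using unif X Y by (auto simp: adj_within_def)
  then have "card (points (nbspace X \<inter> nbspace Y)) = l1"
    using card_points_nbspace_Int[OF X Y(1)] card_common[OF X Y(1)] Y by simp
  then have "l1 + 1 = 2 ^ vec.dim (nbspace X \<inter> nbspace Y)"
    using card_points[OF subspace_nbspace_Int[OF X Y(1)]] q by simp
  then show ?thesis
    using within_empty_equation[of "k + 1" n l1] binary_counting[OF q] l2 n_ge_2 n_less by simp
qed

section \<open>Triviality of q-ary divisible design graphs\<close>

theorem graph_is_trivial:
  "E = complete_graph \<or> E = union_of_complete_graphs \<G> \<or> E = empty_graph"
proof -
  consider "adj_across True" | "adj_across False" | "CARD('f) = 2" "l2 = 1" using across_cases by blast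
  then show ?thesis
  proof cases
    case 1
    then show ?thesis using complete_graphI by blast
  next
    case 2
    then show ?thesis
      using within_cases across_False_l1_one union_graphI empty_graphI by blast
  next
    case 3
    then show ?thesis
      using within_cases within_True_l2_one within_False_l2_one not_both_one by blast
  qed
qed

end

theorem theorem2p11:
  fixes E \<G> :: "('f::{field,finite} ^ 'd) set set"
    and q v n k l1 l2 :: nat
  assumes "primepow q" and "CARD('f) = q"
    and "CARD('d) = v"
    and "2 \<le> n" and "n < v"
    and "spread n \<G>"
    and "q_DDG k l1 l2 n \<G> E"
  shows "E = complete_graph \<or> E = union_of_complete_graphs \<G> \<or> E = empty_graph"
proof -
  interpret divisible_design E \<G> k l1 l2 n
    using assms by unfold_locales auto
  show ?thesis by (rule graph_is_trivial)
qed

end
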